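(* Let $A\in\mathbb{R}^{n\times n}$ be a symmetric positive definite matrix, let $\mu>0$, and let $X^{*}=A^{1/2}$ be the exact (symmetric positive definite) solution of $X^{2}=A$. Let $X_0\in\mathbb{R}^{n\times n}$ be an initial symmetric positive semi-definite matrix, and let $\{X_k\}_{k\ge 0}$ be the sequence generated from $X_0$ by the fixed point iteration $$X_{k+1}=(A+\mu X_k)(X_k+\mu I)^{-1},\quad k=0,1,2,\dots$$ Then there exists a positive constant $\gamma\in(0,1)$ such that, for all $k\ge 0$, $$\delta_T(X_k,X^{*})\le \gamma^{k}\,\delta_T(X_0,X^{*}).$$ Moreover, $\lim_{k\to\infty}X_k=X^{*}$.
   Context: $I$ denotes the $n\times n$ identity matrix, and $A^{1/2}$ denotes the unique symmetric positive definite square root of $A$. The Thompson metric is $$\delta_T(X,Y)=\left\|\log\left(X^{-1/2}YX^{-1/2}\right)\right\|_2,$$ where $\|\cdot\|_2$ is the usual matrix 2-norm (spectral norm) and $\log$ is the matrix logarithm.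
   Formalization: All X_k are assumed symmetric (equivalently, X_0 commutes with A): otherwise δ_T(X_1,X* ) is undefined and X_k may diverge, e.g. A=diag(100,1), μ=1, X_0=[[1,1/2],[1/2,1]]. For singular X_0, δ_T(X_0,X* ) is taken to be infinite. *)

theory Defs
  imports "HOL-Analysis.Analysis"
begin

definition symmetric_mat :: "real^'n^'n \<Rightarrow> bool" where
  "symmetric_mat A \<longleftrightarrow> transpose A = A"

definition pos_semidef_mat :: "real^'n^'n \<Rightarrow> bool" where
  "pos_semidef_mat A \<longleftrightarrow> symmetric_mat A \<and> (\<forall>x. 0 \<le> x \<bullet> (A *v x))"

definition pos_def_mat :: "real^'n^'n \<Rightarrow> bool" where
  "pos_def_mat A \<longleftrightarrow> symmetric_mat A \<and> (\<forall>x. x \<noteq> 0 \<longrightarrow> 0 < x \<bullet> (A *v x))"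

definition sqrt_mat :: "real^'n^'n \<Rightarrow> real^'n^'n" where
  "sqrt_mat A = (THE S. pos_def_mat S \<and> S ** S = A)"

definition power_mat :: "real^'n^'n \<Rightarrow> nat \<Rightarrow> real^'n^'n" where
  "power_mat A k = (((**) A) ^^ k) (mat 1)"

definition exp_mat :: "real^'n^'n \<Rightarrow> real^'n^'n" where
  "exp_mat A = (\<Sum>k. power_mat A k /\<^sub>R fact k)"

(* Meant for symmetric positive definite arguments, where the (principal) logarithm is
   the unique symmetric matrix whose exponential is the given one. *)
definition log_mat :: "real^'n^'n \<Rightarrow> real^'n^'n" where
  "log_mat A = (THE L. symmetric_mat L \<and> exp_mat L = A)"

definition spectral_norm :: "real^'n^'n \<Rightarrow> real" where
  "spectral_norm A = onorm ((*v) A)"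

(* The formula makes sense on symmetric positive definite matrices only.  Elsewhere the value
   is infinite: this is the usual convention for the distance between an interior point of the
   cone of positive semidefinite matrices and a point of its boundary. *)
definition thompson_dist :: "real^'n^'n \<Rightarrow> real^'n^'n \<Rightarrow> ereal" where
  "thompson_dist X Y =
     (if pos_def_mat X \<and> pos_def_mat Y
      then ereal (spectral_norm (log_mat (matrix_inv (sqrt_mat X) ** Y ** matrix_inv (sqrt_mat X))))
      else \<infinity>)"

lemma invertible_add_scaled_id:
  fixes X :: "real^'n^'n"
  assumes "pos_semidef_mat X" "0 < \<mu>"
  shows "invertible (X + \<mu> *\<^sub>R mat 1)"
proof -
  have "x = 0" if "(X + \<mu> *\<^sub>R mat 1) *v x = 0" for x :: "real^'n"
  proof -
    have "0 = x \<bullet> (X *v x) + \<mu> * (x \<bullet> x)"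
      using arg_cong[OF that, of "inner x"]
      by (simp add: matrix_vector_mult_add_rdistrib inner_add_right scaleR_matrix_vector_assoc[symmetric])
    moreover have "0 \<le> x \<bullet> (X *v x)" using assms by (simp add: pos_semidef_mat_def)
    ultimately have "\<mu> * (x \<bullet> x) \<le> 0" by linarith
    then show ?thesis using assms(2) inner_gt_zero_iff[of x]
      by (auto simp: mult_le_0_iff simp del: inner_gt_zero_iff)
  qed
  then show ?thesis by (simp add: invertible_left_inverse matrix_left_invertible_ker)
qed

(* Thompson distances between iterates and the square root of A only make sense when the iterates
   are symmetric, and already the first iterate is symmetric only if the initial matrix
   commutes with A. *)
lemma symmetric_iterate_iff:
  fixes A X :: "real^'n^'n"
  assumes A: "symmetric_mat A" and X: "pos_semidef_mat X" and \<mu>: "0 < \<mu>"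
  shows "symmetric_mat ((A + \<mu> *\<^sub>R X) ** matrix_inv (X + \<mu> *\<^sub>R mat 1)) \<longleftrightarrow> A ** X = X ** A"
proof -
  define C where "C = X + \<mu> *\<^sub>R mat 1"
  define D where "D = matrix_inv C"
  define N where "N = A + \<mu> *\<^sub>R X"
  have tadd: "transpose (P + Q) = transpose P + transpose Q"
    and tscl: "transpose (c *\<^sub>R P) = c *\<^sub>R transpose P" for P Q :: "real^'n^'n" and c
    by (simp_all add: transpose_def vec_eq_iff)
  have sX: "transpose X = X" and sA: "transpose A = A"
    using X A by (simp_all add: pos_semidef_mat_def symmetric_mat_def)
  have tC: "transpose C = C" and tN: "transpose N = N"
    by (simp_all add: C_def N_def tadd tscl sX sA transpose_mat)
  have "invertible C" unfolding C_def by (rule invertible_add_scaled_id[OF X \<mu>])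
  then have CD: "C ** D = mat 1" "D ** C = mat 1"
    using someI_ex[of "\<lambda>B. C ** B = mat 1 \<and> B ** C = mat 1"]
    by (auto simp: D_def invertible_def matrix_inv_def)
  have tD: "transpose D ** C = mat 1" "C ** transpose D = mat 1"
    using arg_cong[OF CD(1), of transpose] arg_cong[OF CD(2), of transpose]
    by (simp_all add: matrix_transpose_mul tC transpose_mat)
  have "symmetric_mat ((A + \<mu> *\<^sub>R X) ** matrix_inv (X + \<mu> *\<^sub>R mat 1)) \<longleftrightarrow> transpose D ** N = N ** D"
    by (simp add: symmetric_mat_def matrix_transpose_mul tN flip: C_def D_def N_def)
  also have "\<dots> \<longleftrightarrow> N ** C = C ** N"
  proof
    assume "transpose D ** N = N ** D"
    then have "C ** (transpose D ** N) ** C = C ** (N ** D) ** C" by simp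
    then show "N ** C = C ** N"
      by (metis CD(2) tD(2) matrix_mul_assoc matrix_mul_lid matrix_mul_rid)
  next
    assume "N ** C = C ** N"
    then have "transpose D ** (N ** C) ** D = transpose D ** (C ** N) ** D" by simp
    then show "transpose D ** N = N ** D"
      by (metis CD(1) tD(1) matrix_mul_assoc matrix_mul_lid matrix_mul_rid)
  qed
  also have "\<dots> \<longleftrightarrow> A ** X = X ** A"
  proof -
    have rdist: "(P + Q) ** R = P ** R + Q ** R" for P Q R :: "real^'n^'n"
      by (simp add: matrix_matrix_mult_def vec_eq_iff distrib_right sum.distrib)
    show ?thesis
      by (simp add: N_def C_def matrix_add_ldistrib rdist matrix_scalar_ac
          scalar_matrix_assoc[symmetric] algebra_simps)
  qed
  finally show ?thesis .
qed

end

theory Submission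
  imports Defs
begin

text \<open>
  Symmetry of the first iterate forces the initial matrix to commute with \<open>A\<close>
  (\<open>symmetric_iterate_iff\<close>). Commuting symmetric matrices have a common orthonormal eigenbasis
  \<open>u\<close> (\<open>commuting_symmetric_spectral_mat\<close>), and sums, products and inverses of matrices that are
  diagonal in \<open>u\<close> are diagonal in \<open>u\<close> again. So the whole iteration splits into the scalar iterations
  \<open>y \<mapsto> (a\<^sub>i + \<mu> y) / (y + \<mu>)\<close>, one for each eigenvalue \<open>a\<^sub>i = s\<^sub>i\<^sup>2\<close> of \<open>A\<close>, and the square root,
  the logarithm and the spectral norm in the Thompson distance act on the eigenvalues: the distance
  to \<open>A\<^sup>1\<^sup>/\<^sup>2\<close> is the largest \<open>\<bar>ln (s\<^sub>i / x\<^sub>i)\<bar>\<close> (\<open>thompson_dist_spectral_mat\<close>).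

  In the logarithmic coordinate \<open>t = ln (y / s)\<close> the scalar map fixes \<open>0\<close>, and its derivative is at
  most \<open>\<bar>\<mu> - s\<bar> / (\<mu> + s) < 1\<close> in absolute value (\<open>ln_linear_fractional_contraction\<close>). The largest
  of these finitely many factors serves as \<open>\<gamma>\<close>; it is bounded below by \<open>1/2\<close> only because it has to be
  positive even when \<open>\<mu>\<close> equals every \<open>s\<^sub>i\<close>.

  A singular initial matrix has infinite distance to \<open>A\<^sup>1\<^sup>/\<^sup>2\<close>, so the estimate is trivial then.
  But its successor is positive definite, which is why convergence is derived from the contraction
  starting at index \<open>1\<close>.
\<close>

section \<open>Common eigenbases of commuting self-adjoint maps\<close>

text \<open>
  The quadratic form \<open>x \<bullet> f x\<close> attains its maximum \<open>c\<close> on the unit sphere of \<open>V\<close> at some \<open>v\<close>. Then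
  \<open>c * (y \<bullet> y) - y \<bullet> f y\<close> is a nonnegative form on \<open>V\<close> that vanishes at \<open>v\<close>, so its derivative at \<open>v\<close>
  vanishes in every direction of \<open>V\<close>. The direction \<open>f v - c *\<^sub>R v\<close> shows that this vector is zero.
\<close>

lemma self_adjoint_eigenvector_in_subspace:
  fixes f :: "'a::euclidean_space \<Rightarrow> 'a"
  assumes f: "linear f" and self_adj: "\<And>x y. f x \<bullet> y = x \<bullet> f y"
    and V: "subspace V" "f ` V \<subseteq> V" "V \<noteq> {0}"
  obtains v c where "v \<in> V" "norm v = 1" "f v = c *\<^sub>R v"
proof -
  define K where "K = sphere 0 1 \<inter> V"
  obtain x where x: "x \<in> V" "x \<noteq> 0" using V subspace_0 by blast
  have "x /\<^sub>R norm x \<in> K" using x V by (simp add: K_def subspace_scale)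
  moreover have "compact K" unfolding K_def by (intro compact_Int_closed compact_sphere closed_subspace V)
  moreover have "continuous_on K (\<lambda>x. x \<bullet> f x)"
    by (intro continuous_intros linear_continuous_on) (use f in \<open>simp add: linear_linear\<close>)
  ultimately obtain v where v: "v \<in> K" and vmax: "\<And>y. y \<in> K \<Longrightarrow> y \<bullet> f y \<le> v \<bullet> f v"
    using continuous_attains_sup[of K "\<lambda>x. x \<bullet> f x"] by blast
  define c where "c = v \<bullet> f v"
  have vv: "v \<bullet> v = 1" "v \<in> V" using v by (simp_all add: K_def dot_square_norm)
  define w where "w = f v - c *\<^sub>R v"
  have w: "w \<in> V" unfolding w_def using vv V by (intro subspace_diff subspace_scale) auto
  have nonneg: "0 \<le> c * (y \<bullet> y) - y \<bullet> f y" if "y \<in> V" for y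
  proof (cases "y = 0")
    case False
    then have "(y /\<^sub>R norm y) \<bullet> f (y /\<^sub>R norm y) \<le> c"
      unfolding c_def using that V by (intro vmax) (simp add: K_def subspace_scale)
    then have "(y \<bullet> f y) / (norm y)\<^sup>2 \<le> c"
      by (simp add: linear_cmul[OF f] power2_eq_square divide_inverse mult_ac)
    then show ?thesis using False by (simp add: field_simps dot_square_norm)
  qed simp
  \<comment> \<open>The form at \<open>v + t *\<^sub>R w\<close>: its constant term vanishes and its linear term is \<open>- 2 * t * (w \<bullet> w)\<close>.\<close>
  have quad: "2 * t * (w \<bullet> w) \<le> t\<^sup>2 * (c * (w \<bullet> w) - w \<bullet> f w)" for t
  proof -
    have "v + t *\<^sub>R w \<in> V" using vv w V by (intro subspace_add subspace_scale)
    from nonneg[OF this]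
    have "0 \<le> - (2 * t * (w \<bullet> f v - c * (v \<bullet> w))) + t\<^sup>2 * (c * (w \<bullet> w) - w \<bullet> f w)"
      using self_adj[of v w]
      by (simp add: linear_add[OF f] linear_cmul[OF f] inner_add_left inner_add_right vv(1)
          inner_commute c_def[symmetric] power2_eq_square algebra_simps)
    moreover have "w \<bullet> w = w \<bullet> f v - c * (v \<bullet> w)"
      by (metis w_def inner_diff_right inner_scaleR_right inner_commute)
    ultimately show ?thesis by simp
  qed
  have "w \<bullet> w \<le> 0"
  proof (rule ccontr)
    assume "\<not> w \<bullet> w \<le> 0"
    then have p: "w \<bullet> w > 0" by linarith
    \<comment> \<open>A positive bound for the quadratic coefficient; for \<open>t\<close> this small the linear term wins.\<close>
    define q where "q = max 1 (c * (w \<bullet> w) - w \<bullet> f w)"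
    have q: "q > 0" "c * (w \<bullet> w) - w \<bullet> f w \<le> q" by (auto simp: q_def)
    define t where "t = (w \<bullet> w) / q"
    have "2 * t * (w \<bullet> w) \<le> t\<^sup>2 * q"
      using quad[of t] mult_left_mono[OF q(2), of "t\<^sup>2"] by simp
    also have "t\<^sup>2 * q = t * (w \<bullet> w)" using q by (simp add: t_def power2_eq_square)
    finally have "t * (w \<bullet> w) \<le> 0" by simp
    moreover have "t * (w \<bullet> w) > 0" using p q by (simp add: t_def)
    ultimately show False by simp
  qed
  then have "f v = c *\<^sub>R v" by (metis inner_gt_zero_iff not_le right_minus_eq w_def)
  then show thesis using that vv by (simp add: norm_eq_1)
qed

text \<open>
  Since the maps commute, every eigenspace of \<open>f\<close> is mapped into itself by \<open>g\<close>, which therefore has an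
  eigenvector there.
\<close>

lemma commuting_self_adjoint_common_eigenvector_in_subspace:
  fixes f g :: "'a::euclidean_space \<Rightarrow> 'a"
  assumes f: "linear f" "\<And>x y. f x \<bullet> y = x \<bullet> f y" and g: "linear g" "\<And>x y. g x \<bullet> y = x \<bullet> g y"
    and comm: "\<And>x. f (g x) = g (f x)"
    and V: "subspace V" "f ` V \<subseteq> V" "g ` V \<subseteq> V" "V \<noteq> {0}"
  obtains v c d where "v \<in> V" "norm v = 1" "f v = c *\<^sub>R v" "g v = d *\<^sub>R v"
proof -
  obtain v c where v: "v \<in> V" "norm v = 1" "f v = c *\<^sub>R v"
    using self_adjoint_eigenvector_in_subspace[OF f V(1,2,4)] by blast
  define W where "W = {x \<in> V. f x = c *\<^sub>R x}"
  have "subspace W"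
    unfolding W_def using V(1)
    by (auto simp: subspace_def linear_0[OF f(1)] linear_add[OF f(1)] linear_cmul[OF f(1)] scaleR_add_right)
  moreover have "g ` W \<subseteq> W"
    using V(3) by (auto simp: W_def comm linear_cmul[OF g(1)])
  moreover have "W \<noteq> {0}"
  proof -
    have "v \<in> W" using v by (simp add: W_def)
    moreover have "v \<noteq> 0" using v(2) by auto
    ultimately show ?thesis by blast
  qed
  ultimately obtain w d where "w \<in> W" "norm w = 1" "g w = d *\<^sub>R w"
    using self_adjoint_eigenvector_in_subspace[of g W, OF g] by blast
  then show thesis using that[of w c d] by (simp add: W_def)
qed

text \<open>
  Take an orthonormal set of common eigenvectors with as many elements as possible. Its orthogonal
  complement is invariant because the maps are self-adjoint; if it were not zero, it would contain
  one more common eigenvector.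
\<close>

lemma commuting_self_adjoint_common_eigenbasis:
  fixes f g :: "'a::euclidean_space \<Rightarrow> 'a"
  assumes f: "linear f" "\<And>x y. f x \<bullet> y = x \<bullet> f y" and g: "linear g" "\<And>x y. g x \<bullet> y = x \<bullet> g y"
    and comm: "\<And>x. f (g x) = g (f x)"
  obtains S where "pairwise orthogonal S" "\<And>v. v \<in> S \<Longrightarrow> norm v = 1" "card S = DIM('a)"
    "\<And>v. v \<in> S \<Longrightarrow> \<exists>c d. f v = c *\<^sub>R v \<and> g v = d *\<^sub>R v"
proof -
  define P where "P S \<longleftrightarrow> pairwise orthogonal S \<and>
      (\<forall>v\<in>S. norm v = 1 \<and> (\<exists>c d. f v = c *\<^sub>R v \<and> g v = d *\<^sub>R v))" for S
  have indep: "independent S" if "P S" for S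
    using that by (intro pairwise_orthogonal_independent) (auto simp: P_def)
  have "P {}" by (simp add: P_def)
  moreover have "\<forall>S. P S \<longrightarrow> card S < Suc DIM('a)"
    using indep independent_bound by (auto simp: less_Suc_eq_le)
  ultimately obtain S where S: "P S" and max: "\<And>T. P T \<Longrightarrow> card T \<le> card S"
    using ex_has_greatest_nat[of P "{}" card "Suc DIM('a)"] by blast
  define V where "V = orthogonal_comp S"
  have "V = {0}"
  proof (rule ccontr)
    assume "V \<noteq> {0}"
    moreover have "subspace V" unfolding V_def by (rule subspace_orthogonal_comp)
    moreover have "f ` V \<subseteq> V" "g ` V \<subseteq> V"
      using S by (auto simp: V_def orthogonal_comp_def orthogonal_def P_def f(2)[symmetric] g(2)[symmetric])
    ultimately obtain v c d where v: "v \<in> V" "norm v = 1" "f v = c *\<^sub>R v" "g v = d *\<^sub>R v"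
      using commuting_self_adjoint_common_eigenvector_in_subspace[of f g V, OF f g comm] by blast
    then have "P (insert v S)" using S
      by (auto simp: P_def pairwise_insert V_def orthogonal_comp_def orthogonal_commute)
    moreover have "v \<notin> S" using v by (auto simp: V_def orthogonal_comp_def orthogonal_self)
    moreover have "finite S" using indep[OF S] independent_bound by blast
    ultimately show False using max[of "insert v S"] by simp
  qed
  moreover have "orthogonal_comp (span S) \<subseteq> V"
    unfolding V_def by (intro orthogonal_comp_anti_mono span_superset)
  ultimately have "orthogonal_comp (span S) = {0}"
    using subspace_0[OF subspace_orthogonal_comp[of "span S"]] by auto
  then have "span S = UNIV" using orthogonal_comp_self[of "span S"] by simp
  then have "card S = DIM('a)"
    using dim_span_eq_card_independent[OF indep[OF S]] by simp
  then show thesis using that S by (auto simp: P_def)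
qed

section \<open>Matrices diagonal in an orthonormal basis\<close>

definition orthonormal_family :: "('n \<Rightarrow> real^'n) \<Rightarrow> bool" where
  "orthonormal_family u \<longleftrightarrow> (\<forall>i j. u i \<bullet> u j = (if i = j then 1 else 0))"

text \<open>
  The matrix with eigenvalues \<open>d i\<close> and eigenvectors \<open>u i\<close>, as a combination of the rank-one
  projections onto the lines of the \<open>u i\<close>. For fixed \<open>u\<close> it is linear in \<open>d\<close>, so limits and series
  of such matrices can be computed eigenvalue by eigenvalue.
\<close>

definition spectral_mat :: "('n \<Rightarrow> real^'n) \<Rightarrow> ('n \<Rightarrow> real) \<Rightarrow> real^'n^'n" where
  "spectral_mat u d = (\<Sum>i\<in>UNIV. d i *\<^sub>R (\<chi> r c. u i $ r * u i $ c))"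

lemma orthonormal_family_inner:
  "orthonormal_family u \<Longrightarrow> u i \<bullet> u j = (if i = j then 1 else 0)"
  by (simp add: orthonormal_family_def)

lemma spectral_mat_mult_vec: "spectral_mat u d *v x = (\<Sum>i\<in>UNIV. (d i * (u i \<bullet> x)) *\<^sub>R u i)"
proof -
  have "(spectral_mat u d *v x) $ r = (\<Sum>i\<in>UNIV. (d i * (u i \<bullet> x)) *\<^sub>R u i) $ r" for r
  proof -
    have "(spectral_mat u d *v x) $ r = (\<Sum>c\<in>UNIV. \<Sum>i\<in>UNIV. d i * (u i $ r * u i $ c) * x $ c)"
      by (simp add: matrix_vector_mult_def spectral_mat_def sum_distrib_right)
    also have "\<dots> = (\<Sum>i\<in>UNIV. \<Sum>c\<in>UNIV. d i * (u i $ r * u i $ c) * x $ c)" by (rule sum.swap)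
    finally show ?thesis
      by (simp add: inner_vec_def sum_distrib_left sum_distrib_right mult_ac)
  qed
  then show ?thesis by (simp add: vec_eq_iff)
qed

lemma orthonormal_family_expansion:
  fixes u :: "'n \<Rightarrow> real^'n"
  assumes u: "orthonormal_family u"
  shows "(\<Sum>i\<in>UNIV. (u i \<bullet> x) *\<^sub>R u i) = x"
proof -
  note inner = orthonormal_family_inner[OF u]
  have "inj u"
    by (rule injI, rule ccontr) (metis inner zero_neq_one)
  have "independent (range u)"
  proof (rule pairwise_orthogonal_independent)
    show "pairwise orthogonal (range u)"
      by (auto simp: pairwise_def orthogonal_def inner)
    show "0 \<notin> range u" using inner by (metis imageE inner_zero_left zero_neq_one)
  qed
  moreover have "card (range u) = DIM(real^'n)"
    using \<open>inj u\<close> by (simp add: card_image)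
  ultimately have "span (range u) = UNIV"
    using card_eq_dim[of "range u" UNIV] dim_UNIV[where 'a="real^'n"] by auto
  then have "x - (\<Sum>i\<in>UNIV. (u i \<bullet> x) *\<^sub>R u i) \<in> span (range u)" by simp
  moreover have "orthogonal (x - (\<Sum>i\<in>UNIV. (u i \<bullet> x) *\<^sub>R u i)) y" if "y \<in> range u" for y
  proof -
    from that obtain k where "y = u k" by blast
    then show ?thesis
      by (simp add: orthogonal_def inner_diff_left inner_sum_left inner if_distrib inner_commute[of x]
            cong: if_cong)
  qed
  ultimately have "orthogonal (x - (\<Sum>i\<in>UNIV. (u i \<bullet> x) *\<^sub>R u i)) (x - (\<Sum>i\<in>UNIV. (u i \<bullet> x) *\<^sub>R u i))"
    by (rule orthogonal_to_span)
  then show ?thesis by (simp add: orthogonal_def)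
qed

lemma inner_spectral_mat_mult_vec:
  assumes "orthonormal_family u"
  shows "u j \<bullet> (spectral_mat u d *v x) = d j * (u j \<bullet> x)"
  by (simp add: spectral_mat_mult_vec inner_sum_right orthonormal_family_inner[OF assms]
      if_distrib cong: if_cong)

lemma spectral_mat_eigenvector:
  assumes "orthonormal_family u"
  shows "spectral_mat u d *v u k = d k *\<^sub>R u k"
proof -
  have "spectral_mat u d *v u k = (\<Sum>i\<in>UNIV. if i = k then d k *\<^sub>R u k else 0)"
    unfolding spectral_mat_mult_vec using assms by (intro sum.cong) (auto simp: orthonormal_family_def)
  then show ?thesis by simp
qed

text \<open>
  A matrix is determined by its values on a basis. This is the way in which the later identities
  between matrices are reduced to identities between eigenvalues.
\<close>

lemma spectral_mat_unique:
  assumes u: "orthonormal_family u" and eig: "\<And>i. M *v u i = d i *\<^sub>R u i"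
  shows "M = spectral_mat u d"
proof -
  have "M *v x = spectral_mat u d *v x" for x
  proof -
    have "M *v x = M *v (\<Sum>i\<in>UNIV. (u i \<bullet> x) *\<^sub>R u i)"
      by (simp add: orthonormal_family_expansion[OF u])
    also have "\<dots> = (\<Sum>i\<in>UNIV. (u i \<bullet> x) *\<^sub>R (M *v u i))"
      by (simp add: linear_sum linear_cmul[OF matrix_vector_mul_linear])
    finally show ?thesis by (simp add: eig spectral_mat_mult_vec mult.commute)
  qed
  then show ?thesis by (simp add: matrix_eq)
qed

lemma inner_spectral_mat:
  "x \<bullet> (spectral_mat u d *v x) = (\<Sum>i\<in>UNIV. d i * (u i \<bullet> x)\<^sup>2)"
  by (simp add: spectral_mat_mult_vec inner_sum_right inner_commute power2_eq_square mult_ac)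

lemma symmetric_spectral_mat: "symmetric_mat (spectral_mat u d)"
  by (simp add: symmetric_mat_def spectral_mat_def vec_eq_iff transpose_def mult.commute)

lemma pos_semidef_spectral_mat_iff:
  assumes u: "orthonormal_family u"
  shows "pos_semidef_mat (spectral_mat u d) \<longleftrightarrow> (\<forall>i. 0 \<le> d i)"
proof
  assume "pos_semidef_mat (spectral_mat u d)"
  then have "0 \<le> u i \<bullet> (spectral_mat u d *v u i)" for i by (simp add: pos_semidef_mat_def)
  then show "\<forall>i. 0 \<le> d i"
    using u by (simp add: spectral_mat_eigenvector orthonormal_family_def)
next
  assume "\<forall>i. 0 \<le> d i"
  then show "pos_semidef_mat (spectral_mat u d)"
    by (simp add: pos_semidef_mat_def symmetric_spectral_mat inner_spectral_mat sum_nonneg)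
qed

lemma pos_def_spectral_mat_iff:
  assumes u: "orthonormal_family u"
  shows "pos_def_mat (spectral_mat u d) \<longleftrightarrow> (\<forall>i. 0 < d i)"
proof
  assume pd: "pos_def_mat (spectral_mat u d)"
  have uu: "u i \<bullet> u i = 1" for i using u by (simp add: orthonormal_family_def)
  have "0 < u i \<bullet> (spectral_mat u d *v u i)" for i
    using pd uu[of i] by (metis pos_def_mat_def inner_zero_left zero_neq_one)
  then show "\<forall>i. 0 < d i" using u by (simp add: spectral_mat_eigenvector uu)
next
  assume d: "\<forall>i. 0 < d i"
  have "0 < x \<bullet> (spectral_mat u d *v x)" if "x \<noteq> 0" for x
  proof -
    have "\<exists>k. u k \<bullet> x \<noteq> 0"
    proof (rule ccontr)
      assume "\<not> (\<exists>k. u k \<bullet> x \<noteq> 0)"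
      then have "(\<Sum>i\<in>UNIV. (u i \<bullet> x) *\<^sub>R u i) = 0" by simp
      then show False using that orthonormal_family_expansion[OF u, of x] by simp
    qed
    then obtain k where k: "u k \<bullet> x \<noteq> 0" by blast
    have "0 < (\<Sum>i\<in>UNIV. d i * (u i \<bullet> x)\<^sup>2)"
    proof (rule sum_pos2[of _ k])
      show "0 < d k * (u k \<bullet> x)\<^sup>2" using d k by simp
      show "0 \<le> d i * (u i \<bullet> x)\<^sup>2" for i using d[rule_format, of i] by simp
    qed simp_all
    then show ?thesis by (simp only: inner_spectral_mat)
  qed
  then show "pos_def_mat (spectral_mat u d)"
    by (simp add: pos_def_mat_def symmetric_spectral_mat)
qed

lemma spectral_mat_add: "spectral_mat u d + spectral_mat u e = spectral_mat u (\<lambda>i. d i + e i)"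
  by (simp add: spectral_mat_def scaleR_add_left sum.distrib)

lemma spectral_mat_scaleR: "r *\<^sub>R spectral_mat u d = spectral_mat u (\<lambda>i. r * d i)"
  by (simp add: spectral_mat_def scaleR_sum_right)

lemma spectral_mat_mult:
  assumes u: "orthonormal_family u"
  shows "spectral_mat u d ** spectral_mat u e = spectral_mat u (\<lambda>i. d i * e i)"
  by (rule spectral_mat_unique[OF u])
     (simp add: spectral_mat_eigenvector[OF u] matrix_vector_mult_scaleR mult.commute
        flip: matrix_vector_mul_assoc)

lemma spectral_mat_one: "orthonormal_family u \<Longrightarrow> spectral_mat u (\<lambda>_. 1) = mat 1"
  by (rule spectral_mat_unique[symmetric]) simp_all

lemma matrix_inv_spectral_mat:
  assumes u: "orthonormal_family u" and d: "\<And>i. d i \<noteq> 0"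
  shows "matrix_inv (spectral_mat u d) = spectral_mat u (\<lambda>i. inverse (d i))"
proof -
  let ?D = "spectral_mat u d" and ?E = "spectral_mat u (\<lambda>i. inverse (d i))"
  have DE: "?D ** ?E = mat 1" "?E ** ?D = mat 1"
    using d by (simp_all add: spectral_mat_mult[OF u] spectral_mat_one[OF u])
  then have "?D ** matrix_inv ?D = mat 1"
    unfolding matrix_inv_def by (rule_tac someI2[of _ ?E]) auto
  then show ?thesis by (metis DE(2) matrix_mul_assoc matrix_mul_lid matrix_mul_rid)
qed

lemma commuting_symmetric_spectral_mat:
  fixes A B :: "real^'n^'n"
  assumes A: "symmetric_mat A" and B: "symmetric_mat B" and AB: "A ** B = B ** A"
  obtains u a b where "orthonormal_family u" "A = spectral_mat u a" "B = spectral_mat u b"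
proof -
  have adj: "(M *v x) \<bullet> y = x \<bullet> (M *v y)" if "symmetric_mat M" for M :: "real^'n^'n" and x y
    using that dot_lmul_matrix[of x M y] by (metis symmetric_mat_def transpose_matrix_vector)
  obtain S where S: "pairwise orthogonal S" "\<And>v. v \<in> S \<Longrightarrow> norm v = 1" "card S = DIM(real^'n)"
    "\<And>v. v \<in> S \<Longrightarrow> \<exists>c d. A *v v = c *\<^sub>R v \<and> B *v v = d *\<^sub>R v"
    using commuting_self_adjoint_common_eigenbasis[of "(*v) A" "(*v) B",
        OF matrix_vector_mul_linear adj[OF A] matrix_vector_mul_linear adj[OF B]] AB
    by (auto simp: matrix_vector_mul_assoc)
  have "card (UNIV :: 'n set) = card S" using S(3) by simp
  moreover have "finite S" using S(3) by (intro card_ge_0_finite) simp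
  ultimately obtain u where bij: "bij_betw u (UNIV :: 'n set) S"
    using finite_same_card_bij[of "UNIV :: 'n set" S] by auto
  then have uS: "u i \<in> S" for i by (auto simp: bij_betw_def)
  have "u i \<bullet> u j = (if i = j then 1 else 0)" for i j
  proof (cases "i = j")
    case True
    then show ?thesis using S(2)[OF uS[of i]] by (simp add: norm_eq_1)
  next
    case False
    then have "u i \<noteq> u j" using bij by (auto simp: bij_betw_def inj_def)
    then show ?thesis using S(1) uS False by (auto simp: pairwise_def orthogonal_def)
  qed
  then have u: "orthonormal_family u" by (simp add: orthonormal_family_def)
  obtain a b where ab: "\<And>i. A *v u i = a i *\<^sub>R u i" "\<And>i. B *v u i = b i *\<^sub>R u i"
    using S(4)[OF uS] by metis
  show thesis
    using that[OF u] spectral_mat_unique[OF u ab(1)] spectral_mat_unique[OF u ab(2)] by blast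
qed

corollary symmetric_spectral_mat_exists:
  assumes "symmetric_mat A"
  obtains u a where "orthonormal_family u" "A = spectral_mat u a"
  using commuting_symmetric_spectral_mat[OF assms assms refl] by blast

text \<open>
  For uniqueness, let \<open>S\<close> be any positive definite root of a matrix with eigenvalue \<open>d i\<close> at \<open>u i\<close>.
  The factor \<open>S + sqrt (d i)\<close> of \<open>S\<^sup>2 - d i\<close> is positive definite, hence injective, so already the factor
  \<open>S - sqrt (d i)\<close> kills \<open>u i\<close>.
\<close>

lemma sqrt_spectral_mat:
  assumes u: "orthonormal_family u" and d: "\<And>i. 0 < d i"
  shows "sqrt_mat (spectral_mat u d) = spectral_mat u (\<lambda>i. sqrt (d i))"
  unfolding sqrt_mat_def
proof (rule the_equality)
  show "pos_def_mat (spectral_mat u (\<lambda>i. sqrt (d i))) \<and>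
      spectral_mat u (\<lambda>i. sqrt (d i)) ** spectral_mat u (\<lambda>i. sqrt (d i)) = spectral_mat u d"
    using d by (simp add: pos_def_spectral_mat_iff[OF u] spectral_mat_mult[OF u] less_imp_le)
next
  fix S assume S: "pos_def_mat S \<and> S ** S = spectral_mat u d"
  show "S = spectral_mat u (\<lambda>i. sqrt (d i))"
  proof (rule spectral_mat_unique[OF u])
    fix i
    define w where "w = S *v u i - sqrt (d i) *\<^sub>R u i"
    have "S *v (S *v u i) = d i *\<^sub>R u i"
      using S by (simp add: matrix_vector_mul_assoc spectral_mat_eigenvector[OF u])
    then have "S *v w = - sqrt (d i) *\<^sub>R w"
      using d[of i]
      by (simp add: w_def matrix_vector_mult_diff_distrib matrix_vector_mult_scaleR scaleR_diff_right)
    then have "w \<bullet> (S *v w) = - (sqrt (d i) * (w \<bullet> w))" by simp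
    moreover have "0 \<le> sqrt (d i) * (w \<bullet> w)" using d[of i] by simp
    ultimately have "\<not> 0 < w \<bullet> (S *v w)" by linarith
    then have "w = 0" using S by (auto simp: pos_def_mat_def)
    then show "S *v u i = sqrt (d i) *\<^sub>R u i" by (simp add: w_def)
  qed
qed

lemma exp_spectral_mat:
  assumes u: "orthonormal_family u"
  shows "exp_mat (spectral_mat u d) = spectral_mat u (\<lambda>i. exp (d i))"
proof -
  have pow: "power_mat (spectral_mat u d) k = spectral_mat u (\<lambda>i. d i ^ k)" for k
    by (induction k) (simp_all add: power_mat_def spectral_mat_one[OF u] spectral_mat_mult[OF u])
  have "(\<lambda>k. spectral_mat u (\<lambda>i. d i ^ k /\<^sub>R fact k)) sums spectral_mat u (\<lambda>i. exp (d i))"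
    unfolding spectral_mat_def by (intro sums_sum sums_scaleR_left exp_converges)
  then have "(\<lambda>k. power_mat (spectral_mat u d) k /\<^sub>R fact k) sums spectral_mat u (\<lambda>i. exp (d i))"
    by (simp add: pow spectral_mat_scaleR)
  then show ?thesis by (simp add: exp_mat_def sums_iff)
qed

text \<open>
  For uniqueness, a symmetric logarithm \<open>L\<close> has its own orthonormal eigenbasis \<open>w\<close> with eigenvalues \<open>l\<close>.
  Comparing coordinates of \<open>u i\<close> in this basis, only those \<open>w j\<close> with \<open>exp (l j) = d i\<close> contribute.
  As the real exponential is injective, all of them belong to the same eigenvalue \<open>ln (d i)\<close> of \<open>L\<close>.
\<close>

lemma log_spectral_mat:
  assumes u: "orthonormal_family u" and d: "\<And>i. 0 < d i"
  shows "log_mat (spectral_mat u d) = spectral_mat u (\<lambda>i. ln (d i))"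
  unfolding log_mat_def
proof (rule the_equality)
  show "symmetric_mat (spectral_mat u (\<lambda>i. ln (d i))) \<and>
      exp_mat (spectral_mat u (\<lambda>i. ln (d i))) = spectral_mat u d"
    using d by (simp add: symmetric_spectral_mat exp_spectral_mat[OF u])
next
  fix L assume L: "symmetric_mat L \<and> exp_mat L = spectral_mat u d"
  then obtain w l where w: "orthonormal_family w" and Lw: "L = spectral_mat w l"
    using symmetric_spectral_mat_exists by blast
  have eq: "spectral_mat w (\<lambda>j. exp (l j)) = spectral_mat u d"
    using L Lw by (simp add: exp_spectral_mat[OF w])
  show "L = spectral_mat u (\<lambda>i. ln (d i))"
  proof (rule spectral_mat_unique[OF u])
    fix i
    have "l j * (w j \<bullet> u i) = ln (d i) * (w j \<bullet> u i)" for j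
    proof -
      have "w j \<bullet> u i = 0 \<or> exp (l j) = d i"
        using inner_spectral_mat_mult_vec[OF w, of j "\<lambda>j. exp (l j)" "u i"]
        by (auto simp: eq spectral_mat_eigenvector[OF u])
      then show ?thesis by (metis ln_exp mult_zero_right)
    qed
    then have "L *v u i = (\<Sum>j\<in>UNIV. ln (d i) *\<^sub>R ((w j \<bullet> u i) *\<^sub>R w j))"
      by (simp only: Lw spectral_mat_mult_vec scaleR_scaleR)
    also have "\<dots> = ln (d i) *\<^sub>R u i"
      by (simp only: orthonormal_family_expansion[OF w] flip: scaleR_sum_right)
    finally show "L *v u i = ln (d i) *\<^sub>R u i" .
  qed
qed

text \<open>
  The squared coordinates in an orthonormal basis add up to the squared norm, which gives the upper
  bound. The basis vectors themselves give the lower bound.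
\<close>

lemma spectral_norm_spectral_mat:
  fixes d :: "'n::finite \<Rightarrow> real"
  assumes u: "orthonormal_family u"
  shows "spectral_norm (spectral_mat u d) = (MAX i. \<bar>d i\<bar>)"
proof -
  have blin: "bounded_linear ((*v) (spectral_mat u d))" by simp
  have norm_sq: "(norm x)\<^sup>2 = (\<Sum>i\<in>UNIV. (u i \<bullet> x)\<^sup>2)" for x
    using inner_spectral_mat[of x u "\<lambda>_. 1"] by (simp add: spectral_mat_one[OF u] dot_square_norm)
  show ?thesis
  proof (rule antisym)
    have "norm (spectral_mat u d *v x) \<le> (MAX i. \<bar>d i\<bar>) * norm x" for x
    proof (rule power2_le_imp_le)
      have "\<bar>d i\<bar> \<le> (MAX i. \<bar>d i\<bar>)" for i by simp
      then have le: "(d i)\<^sup>2 \<le> (MAX i. \<bar>d i\<bar>)\<^sup>2" for i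
        by (metis abs_ge_zero power2_abs power_mono)
      have "(norm (spectral_mat u d *v x))\<^sup>2 = (\<Sum>i\<in>UNIV. (d i)\<^sup>2 * (u i \<bullet> x)\<^sup>2)"
        by (simp add: norm_sq inner_spectral_mat_mult_vec[OF u] power_mult_distrib)
      also have "\<dots> \<le> (\<Sum>i\<in>UNIV. (MAX i. \<bar>d i\<bar>)\<^sup>2 * (u i \<bullet> x)\<^sup>2)"
        by (intro sum_mono mult_right_mono le) simp
      also have "\<dots> = ((MAX i. \<bar>d i\<bar>) * norm x)\<^sup>2"
        by (simp add: norm_sq power_mult_distrib sum_distrib_left)
      finally show "(norm (spectral_mat u d *v x))\<^sup>2 \<le> ((MAX i. \<bar>d i\<bar>) * norm x)\<^sup>2" .
      show "0 \<le> (MAX i. \<bar>d i\<bar>) * norm x"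
        by (intro mult_nonneg_nonneg) (auto simp: Max_ge_iff)
    qed
    then show "spectral_norm (spectral_mat u d) \<le> (MAX i. \<bar>d i\<bar>)"
      unfolding spectral_norm_def by (rule onorm_le)
  next
    have "\<bar>d i\<bar> \<le> spectral_norm (spectral_mat u d)" for i
    proof -
      have "norm (u i) = 1" using u by (simp add: norm_eq_1 orthonormal_family_def)
      then show ?thesis
        using onorm[OF blin, of "u i"] by (simp add: spectral_norm_def spectral_mat_eigenvector[OF u])
    qed
    then show "(MAX i. \<bar>d i\<bar>) \<le> spectral_norm (spectral_mat u d)" by simp
  qed
qed

lemma thompson_dist_spectral_mat:
  fixes d e :: "'n::finite \<Rightarrow> real"
  assumes u: "orthonormal_family u" and d: "\<And>i. 0 < d i" and e: "\<And>i. 0 < e i"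
  shows "thompson_dist (spectral_mat u d) (spectral_mat u e) = ereal (MAX i. \<bar>ln (e i / d i)\<bar>)"
proof -
  let ?R = "matrix_inv (sqrt_mat (spectral_mat u d))"
  have nz: "sqrt (d i) \<noteq> 0" for i using d[of i] by simp
  have eq: "inverse (sqrt (d i)) * e i * inverse (sqrt (d i)) = e i / d i" for i
    using d[of i] by (simp add: field_simps)
  have "?R ** spectral_mat u e ** ?R = spectral_mat u (\<lambda>i. e i / d i)"
    by (simp only: sqrt_spectral_mat[OF u d] matrix_inv_spectral_mat[OF u nz] spectral_mat_mult[OF u] eq)
  then show ?thesis
    using d e by (simp add: thompson_dist_def pos_def_spectral_mat_iff[OF u]
        log_spectral_mat[OF u] spectral_norm_spectral_mat[OF u])
qed

section \<open>The iteration on a single eigenvalue\<close>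

text \<open>
  With \<open>t = ln (x / s)\<close>, the logarithm on the left is a function \<open>g\<close> of \<open>t\<close> that vanishes at \<open>0\<close>, and
  \<open>g' t = y * (s\<^sup>2 - \<mu>\<^sup>2) / ((\<mu> + s * y) * (s + \<mu> * y))\<close> for \<open>y = exp t\<close>. The denominator exceeds
  \<open>y * (\<mu> + s)\<^sup>2\<close> by \<open>s * \<mu> * (y - 1)\<^sup>2\<close>, so \<open>\<bar>\<mu> - s\<bar> / (\<mu> + s)\<close> bounds the derivative, and the mean
  value theorem gives the claim.
\<close>

lemma ln_linear_fractional_contraction:
  fixes s \<mu> x :: real
  assumes s: "0 < s" and \<mu>: "0 < \<mu>" and x: "0 < x"
  shows "\<bar>ln (s / ((s\<^sup>2 + \<mu> * x) / (x + \<mu>)))\<bar> \<le> \<bar>\<mu> - s\<bar> / (\<mu> + s) * \<bar>ln (s / x)\<bar>"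
proof -
  define g where "g t = ln (\<mu> + s * exp t) - ln (s + \<mu> * exp t)" for t
  define g' where "g' t = s * exp t / (\<mu> + s * exp t) - \<mu> * exp t / (s + \<mu> * exp t)" for t
  have pos: "0 < \<mu> + s * exp t" "0 < s + \<mu> * exp t" for t
    using s \<mu> by (simp_all add: add_pos_pos)
  have deriv: "(g has_real_derivative g' t) (at t)" for t
    unfolding g_def g'_def using pos[of t]
    by (auto intro!: derivative_eq_intros simp: divide_inverse)
  have bound: "norm (g' t) \<le> \<bar>\<mu> - s\<bar> / (\<mu> + s)" for t
  proof -
    define y where "y = exp t"
    have y: "0 < y" by (simp add: y_def)
    let ?D = "(\<mu> + s * y) * (s + \<mu> * y)"
    have D: "0 < ?D" using pos[of t] by (simp add: y_def)
    have "g' t = (s * y * (s + \<mu> * y) - \<mu> * y * (\<mu> + s * y)) / ?D"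
      unfolding g'_def y_def using pos[of t] by (intro diff_frac_eq) auto
    also have "s * y * (s + \<mu> * y) - \<mu> * y * (\<mu> + s * y) = y * ((s - \<mu>) * (\<mu> + s))"
      by (simp add: algebra_simps)
    finally have "\<bar>g' t\<bar> = y * (\<bar>\<mu> - s\<bar> * (\<mu> + s)) / ?D"
      using D y s \<mu> by (simp add: abs_mult abs_minus_commute)
    also have "\<dots> \<le> \<bar>\<mu> - s\<bar> / (\<mu> + s)"
    proof -
      have "0 \<le> s * \<mu> * (y - 1)\<^sup>2" using s \<mu> by simp
      then have "y * (\<mu> + s)\<^sup>2 \<le> ?D" by (simp add: power2_eq_square algebra_simps)
      then have "\<bar>\<mu> - s\<bar> * (y * (\<mu> + s)\<^sup>2) \<le> \<bar>\<mu> - s\<bar> * ?D"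
        by (rule mult_left_mono) simp
      then show ?thesis
        using D s \<mu> by (simp add: divide_le_eq le_divide_eq power2_eq_square mult_ac)
    qed
    finally show ?thesis by simp
  qed
  have "norm (g (ln (x / s)) - g 0) \<le> \<bar>\<mu> - s\<bar> / (\<mu> + s) * norm (ln (x / s) - 0)"
    using deriv bound by (intro field_differentiable_bound[of UNIV g g']) auto
  moreover have "g 0 = 0" by (simp add: g_def add.commute)
  moreover have "g (ln (x / s)) = ln (s / ((s\<^sup>2 + \<mu> * x) / (x + \<mu>)))"
  proof -
    have "exp (ln (x / s)) = x / s" using s x by (intro exp_ln) simp
    then have "g (ln (x / s)) = ln (x + \<mu>) - ln ((s\<^sup>2 + \<mu> * x) / s)"
      unfolding g_def using s by (simp add: power2_eq_square add_divide_distrib add.commute)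
    also have "\<dots> = ln ((x + \<mu>) / ((s\<^sup>2 + \<mu> * x) / s))"
      using s \<mu> x by (intro ln_divide_pos[symmetric] divide_pos_pos add_pos_pos) auto
    also have "(x + \<mu>) / ((s\<^sup>2 + \<mu> * x) / s) = s / ((s\<^sup>2 + \<mu> * x) / (x + \<mu>))"
      by simp
    finally show ?thesis .
  qed
  moreover have "\<bar>ln (x / s)\<bar> = \<bar>ln (s / x)\<bar>"
    using s x by (simp only: ln_divide_pos abs_minus_commute)
  ultimately show ?thesis by (simp only: real_norm_def diff_zero)
qed

section \<open>The matrix iteration\<close>

theorem theorem3p1:
  fixes A :: "real^'n^'n" and \<mu> :: real and X :: "nat \<Rightarrow> real^'n^'n"
  assumes "pos_def_mat A"
    and "0 < \<mu>"
    and "pos_semidef_mat (X 0)"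
    and "\<And>k. X (Suc k) = (A + \<mu> *\<^sub>R X k) ** matrix_inv (X k + \<mu> *\<^sub>R mat 1)"
    and "\<And>k. symmetric_mat (X k)"
  shows "(\<exists>\<gamma>. 0 < \<gamma> \<and> \<gamma> < 1 \<and>
           (\<forall>k. thompson_dist (X k) (sqrt_mat A) \<le> ereal (\<gamma> ^ k) * thompson_dist (X 0) (sqrt_mat A)))
         \<and> X \<longlonglongrightarrow> sqrt_mat A"
proof -
  note iter = assms(4) and \<mu> = assms(2)
  have symA: "symmetric_mat A" using assms(1) by (simp add: pos_def_mat_def)
  have "A ** X 0 = X 0 ** A"
    using symmetric_iterate_iff[OF symA assms(3) \<mu>] assms(5)[of 1] iter[of 0] by simp
  then obtain u a x0 where u: "orthonormal_family u"
    and A: "A = spectral_mat u a" and X0: "X 0 = spectral_mat u x0"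
    using commuting_symmetric_spectral_mat[OF symA assms(5)] by blast
  define s where "s i = sqrt (a i)" for i
  have a: "0 < a i" for i using assms(1) by (simp add: A pos_def_spectral_mat_iff[OF u])
  then have s: "0 < s i" and a_eq: "a i = (s i)\<^sup>2" for i
    by (simp_all add: s_def less_imp_le)
  have sqrtA: "sqrt_mat A = spectral_mat u s"
    unfolding A s_def using a by (rule sqrt_spectral_mat[OF u])
  define x where "x k i = ((\<lambda>y. (a i + \<mu> * y) / (y + \<mu>)) ^^ k) (x0 i)" for k i
  have x_Suc: "x (Suc k) i = (a i + \<mu> * x k i) / (x k i + \<mu>)" for k i
    by (simp add: x_def)
  have x0: "0 \<le> x 0 i" for i
    using assms(3) by (simp add: X0 x_def pos_semidef_spectral_mat_iff[OF u])
  have x_pos_Suc: "0 < x (Suc k) i" for k i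
  proof (induction k)
    case 0
    show ?case
      unfolding x_Suc using x0[of i] a[of i] \<mu> by (intro divide_pos_pos add_pos_nonneg add_nonneg_pos) auto
  next
    case (Suc k)
    then show ?case
      unfolding x_Suc[of "Suc k"] using a[of i] \<mu> by (intro divide_pos_pos add_pos_pos) auto
  qed
  have x_nonneg: "0 \<le> x k i" for k i
    using x0 x_pos_Suc by (cases k) (auto simp: less_imp_le)
  have X: "X k = spectral_mat u (x k)" for k
  proof (induction k)
    case 0
    show ?case by (simp add: X0 x_def)
  next
    case (Suc k)
    have nz: "x k i + \<mu> \<noteq> 0" for i using x_nonneg[of k i] \<mu> by linarith
    have eq: "(a i + \<mu> * x k i) * inverse (x k i + \<mu>) = x (Suc k) i" for i
      by (simp add: x_Suc divide_inverse)
    have "X k + \<mu> *\<^sub>R mat 1 = spectral_mat u (\<lambda>i. x k i + \<mu>)"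
      by (simp add: Suc spectral_mat_scaleR spectral_mat_add flip: spectral_mat_one[OF u])
    moreover have "A + \<mu> *\<^sub>R X k = spectral_mat u (\<lambda>i. a i + \<mu> * x k i)"
      by (simp add: A Suc spectral_mat_scaleR spectral_mat_add)
    ultimately show ?case
      by (simp add: iter matrix_inv_spectral_mat[OF u nz] spectral_mat_mult[OF u] eq)
  qed
  \<comment> \<open>The maximum alone is zero if \<open>\<mu>\<close> equals every \<open>s i\<close>, but \<open>\<gamma>\<close> must be positive.\<close>
  define \<gamma> where "\<gamma> = max (1/2) (MAX i. \<bar>\<mu> - s i\<bar> / (\<mu> + s i))"
  have \<gamma>: "0 < \<gamma>" "\<gamma> < 1"
    using s \<mu> by (auto simp: \<gamma>_def divide_less_eq abs_less_iff add_pos_pos)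
  have step: "\<bar>ln (s i / x (Suc k) i)\<bar> \<le> \<gamma> * \<bar>ln (s i / x k i)\<bar>" if "0 < x k i" for k i
  proof -
    have "\<bar>ln (s i / x (Suc k) i)\<bar> \<le> \<bar>\<mu> - s i\<bar> / (\<mu> + s i) * \<bar>ln (s i / x k i)\<bar>"
      unfolding x_Suc a_eq by (rule ln_linear_fractional_contraction[OF s \<mu> that])
    also have "\<dots> \<le> \<gamma> * \<bar>ln (s i / x k i)\<bar>"
      by (intro mult_right_mono) (auto simp: \<gamma>_def le_max_iff_disj)
    finally show ?thesis .
  qed
  have iterated: "\<bar>ln (s i / x (m + k) i)\<bar> \<le> \<gamma> ^ k * \<bar>ln (s i / x m i)\<bar>" if "0 < x m i" for m k i
  proof (induction k)
    case (Suc k)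
    have "0 < x (m + k) i" using that x_pos_Suc[of "m + k - 1" i] by (cases "m + k") auto
    from step[OF this] have "\<bar>ln (s i / x (m + Suc k) i)\<bar> \<le> \<gamma> * \<bar>ln (s i / x (m + k) i)\<bar>" by simp
    also have "\<dots> \<le> \<gamma> * (\<gamma> ^ k * \<bar>ln (s i / x m i)\<bar>)"
      using Suc \<gamma> by (intro mult_left_mono) auto
    finally show ?case by (simp add: mult.assoc)
  qed simp
  have "thompson_dist (X k) (sqrt_mat A) \<le> ereal (\<gamma> ^ k) * thompson_dist (X 0) (sqrt_mat A)" for k
  proof (cases "\<forall>i. 0 < x 0 i")
    case True
    have "0 < x k i" for i using True x_pos_Suc by (cases k) auto
    then have "thompson_dist (X k) (sqrt_mat A) = ereal (MAX i. \<bar>ln (s i / x k i)\<bar>)"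
      unfolding X sqrtA using s by (rule thompson_dist_spectral_mat[OF u])
    moreover have "thompson_dist (X 0) (sqrt_mat A) = ereal (MAX i. \<bar>ln (s i / x 0 i)\<bar>)"
      unfolding X sqrtA using True s by (intro thompson_dist_spectral_mat[OF u]) auto
    moreover have "(MAX i. \<bar>ln (s i / x k i)\<bar>) \<le> \<gamma> ^ k * (MAX i. \<bar>ln (s i / x 0 i)\<bar>)"
    proof -
      have "\<bar>ln (s i / x k i)\<bar> \<le> \<gamma> ^ k * (MAX i. \<bar>ln (s i / x 0 i)\<bar>)" for i
      proof -
        have "\<bar>ln (s i / x k i)\<bar> \<le> \<gamma> ^ k * \<bar>ln (s i / x 0 i)\<bar>"
          using iterated[of 0 i k] True by simp
        also have "\<dots> \<le> \<gamma> ^ k * (MAX i. \<bar>ln (s i / x 0 i)\<bar>)"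
          using \<gamma> by (intro mult_left_mono) auto
        finally show ?thesis .
      qed
      then show ?thesis by simp
    qed
    ultimately show ?thesis by simp
  next
    case False
    then have "thompson_dist (X 0) (sqrt_mat A) = \<infinity>"
      by (simp add: thompson_dist_def X pos_def_spectral_mat_iff[OF u])
    then show ?thesis using \<gamma> by simp
  qed
  moreover have "X \<longlonglongrightarrow> sqrt_mat A"
  proof -
    have "(\<lambda>k. x k i) \<longlonglongrightarrow> s i" for i
    proof -
      have "(\<lambda>k. \<gamma> ^ k * \<bar>ln (s i / x 1 i)\<bar>) \<longlonglongrightarrow> 0"
        using \<gamma> by (intro tendsto_mult_left_zero LIMSEQ_power_zero) simp
      then have "(\<lambda>k. ln (s i / x (Suc k) i)) \<longlonglongrightarrow> 0"
        by (rule Lim_null_comparison[rotated]) (use iterated[of 1 i] x_pos_Suc[of 0 i] in simp)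
      then have "(\<lambda>k. s i * exp (- ln (s i / x (Suc k) i))) \<longlonglongrightarrow> s i * exp (- 0)"
        by (intro tendsto_intros)
      moreover have "s i * exp (- ln (s i / x (Suc k) i)) = x (Suc k) i" for k
        using s[of i] x_pos_Suc[of k i] by (simp add: exp_minus)
      ultimately have "(\<lambda>k. x (Suc k) i) \<longlonglongrightarrow> s i" by simp
      then show ?thesis by (rule LIMSEQ_imp_Suc)
    qed
    then have "(\<lambda>k. spectral_mat u (x k)) \<longlonglongrightarrow> spectral_mat u s"
      unfolding spectral_mat_def by (intro tendsto_intros)
    moreover have "X = (\<lambda>k. spectral_mat u (x k))" using X by blast
    ultimately show ?thesis by (simp add: sqrtA)
  qed
  ultimately show ?thesis using \<gamma> by blast
qed

end
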